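(* For any integers $v\ge w\ge t\ge 2$, $$M_t(w,v)\ge v-w+1.$$
   Context: A set system is a pair $(\mathcal{X},\mathcal{B})$ where $\mathcal{X}$ is a finite set of points and $\mathcal{B}$ is a collection (set) of subsets of $\mathcal{X}$ called blocks; its size is $|\mathcal{B}|$. $\binom{\mathcal{X}}{w}$ denotes the collection of all $w$-subsets of $\mathcal{X}$. A $t$-traceability scheme $t$-TS$(w,v)$ is a set system $(\mathcal{X},\mathcal{B})$ with $|\mathcal{X}|=v$ and $\mathcal{B}\subseteq\binom{\mathcal{X}}{w}$ such that for every choice of $s$ blocks $B_1,\ldots,B_s\in\mathcal{B}$ with $1\le s\le t$ and for any $w$-subset $T\subseteq\bigcup_{1\le j\le s}B_j$, there does not exist a block $B\in\mathcal{B}\setminus\{B_1,\ldots,B_s\}$ such that $|T\cap B|\ge|T\cap B_j|$ for all $1\le j\le s$. $M_t(w,v)$ denotes the maximum size of a $t$-TS$(w,v)$. *)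

theory Defs
  imports Main
begin

definition set_system :: "'a set \<Rightarrow> 'a set set \<Rightarrow> bool" where
  "set_system X \<B> \<longleftrightarrow> finite X \<and> \<B> \<subseteq> Pow X"

text \<open>The chosen blocks form a family indexed by \<open>{1..s}\<close>. Repetitions are permitted; since
  every smaller \<open>s \<ge> 1\<close> is also covered, requiring distinct blocks would give the same notion.\<close>

definition traceability_scheme ::
    "nat \<Rightarrow> nat \<Rightarrow> nat \<Rightarrow> 'a set \<Rightarrow> 'a set set \<Rightarrow> bool" where
  "traceability_scheme t w v X \<B> \<longleftrightarrow>
     set_system X \<B> \<and> card X = v \<and> \<B> \<subseteq> {B. B \<subseteq> X \<and> card B = w} \<and>
     (\<forall>s C T. 1 \<le> s \<and> s \<le> t \<and> (\<forall>j\<in>{1..s}. C j \<in> \<B>) \<and>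
        T \<subseteq> (\<Union>j\<in>{1..s}. C j) \<and> card T = w \<longrightarrow>
        \<not> (\<exists>B \<in> \<B> - C ` {1..s}. \<forall>j\<in>{1..s}. card (T \<inter> B) \<ge> card (T \<inter> C j)))"

text \<open>The points range over finite sets of naturals. The notion is invariant under bijections of
  the point set, so this loses no generality.\<close>

definition max_ts_size :: "nat \<Rightarrow> nat \<Rightarrow> nat \<Rightarrow> nat" where
  "max_ts_size t w v =
     Max {card \<B> | (X :: nat set) \<B>. traceability_scheme t w v X \<B>}"

text \<open>The maximum is taken over a finite nonempty set.\<close>

lemma finite_ts_sizes:
  "finite {card \<B> | (X :: nat set) \<B>. traceability_scheme t w v X \<B>}"
proof (rule finite_subset)
  show "{card \<B> | (X :: nat set) \<B>. traceability_scheme t w v X \<B>} \<subseteq> {..2 ^ v}"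
  proof
    fix n
    assume "n \<in> {card \<B> | (X :: nat set) \<B>. traceability_scheme t w v X \<B>}"
    then obtain X :: "nat set" and \<B> where n: "n = card \<B>"
      and "traceability_scheme t w v X \<B>"
      by blast
    then have "finite X" "\<B> \<subseteq> Pow X" "card X = v"
      by (auto simp: traceability_scheme_def set_system_def)
    then have "card \<B> \<le> card (Pow X)"
      by (intro card_mono) auto
    with \<open>finite X\<close> \<open>card X = v\<close> show "n \<in> {..2 ^ v}"
      by (simp add: card_Pow n)
  qed
qed simp

lemma ts_sizes_nonempty:
  "{card \<B> | (X :: nat set) \<B>. traceability_scheme t w v X \<B>} \<noteq> {}"
proof -
  have "traceability_scheme t w v {..<v} {}"
    by (auto simp: traceability_scheme_def set_system_def)
  then show ?thesis
    by blast
qed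

end

theory Submission
  imports Defs
begin

text \<open>Take a sunflower whose blocks consist of a kernel of \<open>w - 1\<close> points and one petal
  point each. A \<open>w\<close>-set covered by some of the blocks is too large for the kernel, so it contains
  the petal point of one of these blocks, and that block meets it in one point more than any block
  outside the coalition.\<close>

lemma traceability_scheme_sunflower:
  fixes K P :: "'a set"
  assumes fin: "finite K" "finite P" and disj: "K \<inter> P = {}"
  shows "traceability_scheme t (Suc (card K)) (card K + card P) (K \<union> P) ((\<lambda>x. insert x K) ` P)"
  unfolding traceability_scheme_def
proof (intro conjI allI impI)
  show "set_system (K \<union> P) ((\<lambda>x. insert x K) ` P)"
    using fin by (auto simp: set_system_def)
  show "card (K \<union> P) = card K + card P"
    using fin disj by (simp add: card_Un_disjoint)
  show "(\<lambda>x. insert x K) ` P \<subseteq> {B. B \<subseteq> K \<union> P \<and> card B = Suc (card K)}"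
    using fin disj by (auto simp: card_insert_if)
next
  fix s C T
  assume "1 \<le> s \<and> s \<le> t \<and> (\<forall>j\<in>{1..s}. C j \<in> (\<lambda>x. insert x K) ` P) \<and>
    T \<subseteq> (\<Union>j\<in>{1..s}. C j) \<and> card T = Suc (card K)"
  then have C: "\<And>j. j \<in> {1..s} \<Longrightarrow> C j \<in> (\<lambda>x. insert x K) ` P"
    and T: "T \<subseteq> (\<Union>j\<in>{1..s}. C j)" and card_T: "card T = Suc (card K)"
    by blast+
  \<comment> \<open>An infinite set has \<open>card\<close> 0, so a successor as cardinality forces
    finiteness.\<close>
  have "finite T"
    using card_T by (simp add: card_ge_0_finite)
  have "\<not> T \<subseteq> K"
    using card_mono[OF fin(1), of T] card_T by auto
  then obtain x where x: "x \<in> T" "x \<notin> K"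
    by blast
  then obtain j where j: "j \<in> {1..s}" "x \<in> C j"
    using T by blast
  obtain z where "C j = insert z K"
    using C[OF j(1)] by blast
  with j(2) x(2) have Cj: "C j = insert x K"
    by simp
  show "\<not> (\<exists>B \<in> (\<lambda>x. insert x K) ` P - C ` {1..s}.
    \<forall>j\<in>{1..s}. card (T \<inter> C j) \<le> card (T \<inter> B))"
  proof
    assume "\<exists>B \<in> (\<lambda>x. insert x K) ` P - C ` {1..s}.
      \<forall>j\<in>{1..s}. card (T \<inter> C j) \<le> card (T \<inter> B)"
    then obtain y where y: "y \<in> P" "insert y K \<notin> C ` {1..s}"
      and le: "\<forall>j\<in>{1..s}. card (T \<inter> C j) \<le> card (T \<inter> insert y K)"
      by blast
    \<comment> \<open>A petal point in \<open>T\<close> is covered by some \<open>C i\<close>; lying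
      outside \<open>K\<close>, it must be the petal of \<open>C i\<close>, which would put
      \<open>insert y K\<close> in the coalition.\<close>
    have "y \<notin> T"
    proof
      assume "y \<in> T"
      then obtain i where i: "i \<in> {1..s}" "y \<in> C i"
        using T by blast
      obtain z where z: "C i = insert z K"
        using C[OF i(1)] by blast
      have "y \<notin> K"
        using y(1) disj by blast
      then have "C i = insert y K"
        using i(2) z by simp
      then show False
        using y(2) i(1) by (metis imageI)
    qed
    \<comment> \<open>Without \<open>y\<close>, the left side is just \<open>T \<inter> K\<close>,
      while the right side also contains \<open>x\<close>.\<close>
    then have "T \<inter> insert y K \<subset> T \<inter> C j"
      unfolding Cj using x by auto
    then have "card (T \<inter> insert y K) < card (T \<inter> C j)"
      using \<open>finite T\<close> by (intro psubset_card_mono) auto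
    then show False
      using le j(1) by (meson not_le)
  qed
qed

lemma card_le_max_ts_size:
  assumes "traceability_scheme t w v (X :: nat set) \<B>"
  shows "card \<B> \<le> max_ts_size t w v"
  unfolding max_ts_size_def using assms by (intro Max_ge finite_ts_sizes) blast

theorem theoremV1:
  fixes t w v :: nat
  assumes "v \<ge> w" and "w \<ge> t" and "t \<ge> 2"
  shows "max_ts_size t w v \<ge> v - w + 1"
proof -
  \<comment> \<open>One block per petal: after \<open>w - 1\<close> kernel points,
    \<open>v - w + 1\<close> of the \<open>v\<close> points remain as petals.\<close>
  define K P where "K = {..<w - 1}" and "P = {w - 1..<v}"
  have "traceability_scheme t (Suc (card K)) (card K + card P) (K \<union> P) ((\<lambda>x. insert x K) ` P)"
    by (rule traceability_scheme_sunflower) (auto simp: K_def P_def)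
  \<comment> \<open>Subtraction does not truncate here, since \<open>w \<ge> 2\<close> and
    \<open>w - 1 \<le> v\<close>.\<close>
  moreover have "Suc (card K) = w" "card K + card P = v"
    using assms by (simp_all add: K_def P_def)
  ultimately have "card ((\<lambda>x. insert x K) ` P) \<le> max_ts_size t w v"
    using card_le_max_ts_size by simp
  \<comment> \<open>Petals lie outside the kernel, so a block determines its petal and distinct
    petals give distinct blocks.\<close>
  moreover have "inj_on (\<lambda>x. insert x K) P"
    by (auto simp: inj_on_def K_def P_def)
  then have "card ((\<lambda>x. insert x K) ` P) = v - w + 1"
    using assms by (simp add: card_image P_def)
  ultimately show ?thesis
    by simp
qed

end
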